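(* Let $r,N\ge 1$ be integers, let $\gamma_j(\bar x)=x_1^{k_{j1}}x_2^{k_{j2}}\cdots x_r^{k_{jr}}$ ($j=1,\dots,N$) be pairwise distinct monomials of positive degree in $\bar x=(x_1,\dots,x_r)$, and let $\rho$ be the rank of the $N\times r$ matrix of exponents $(k_{ji})_{1\le j\le N,\,1\le i\le r}$. If $k$ is a natural number such that $k\rho<N$, then the special integral $$\theta_k=\int_{-\infty}^{\infty}\cdots\int_{-\infty}^{\infty}\left|\int_0^1\cdots\int_0^1 e^{2\pi i F(\bar x)}\,d\bar x\right|^{2k}d\alpha_1\cdots d\alpha_N,\qquad F(\bar x)=\sum_{j=1}^N\alpha_j\gamma_j(\bar x),$$ diverges.
   Context: Exponents $k_{ji}$ are non-negative integers with $k_{j1}+\cdots+k_{jr}>0$ for every $j=1,\dots,N$ (no constant term). The inner integral in $\theta_k$ is over the unit cube $[0,1]^r$ and depends on the real parameters $\alpha_1,\dots,\alpha_N$; the outer integral is over $\mathbb R^N$. Since the outer integrand is non-negative, "diverges" means $\theta_k=+\infty$. *)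

theory Defs
  imports "HOL-Analysis.Analysis"
begin

definition monomial :: "nat ^ 'r \<Rightarrow> real ^ 'r \<Rightarrow> real" where
  "monomial e x = (\<Prod>i\<in>UNIV. x $ i ^ (e $ i))"

definition exponent_matrix :: "nat ^ 'r ^ 'n \<Rightarrow> real ^ 'r ^ 'n" where
  "exponent_matrix K = (\<chi> j i. real (K $ j $ i))"

definition phase :: "nat ^ 'r ^ 'n \<Rightarrow> real ^ 'n \<Rightarrow> real ^ 'r \<Rightarrow> real" where
  "phase K \<alpha> x = (\<Sum>j\<in>UNIV. \<alpha> $ j * monomial (K $ j) x)"

text \<open>In the box below, \<open>0\<close> and \<open>1\<close> are the constant vectors, so it is the closed unit cube.\<close>

definition trig_integral :: "nat ^ 'r ^ 'n \<Rightarrow> real ^ 'n \<Rightarrow> complex" where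
  "trig_integral K \<alpha> =
    (LINT x:cbox 0 1|lborel. exp (2 * of_real pi * \<i> * of_real (phase K \<alpha> x)))"

text \<open>The outer integral of a non-negative function takes values in \<open>[0, \<infinity>]\<close>;
  divergence is the value \<open>\<infinity>\<close>.\<close>

definition special_integral :: "nat \<Rightarrow> nat ^ 'r ^ 'n \<Rightarrow> ennreal" where
  "special_integral k K =
    (\<integral>\<^sup>+ \<alpha>. ennreal (cmod (trig_integral K \<alpha>) ^ (2 * k)) \<partial>lborel)"

end

theory Submission
  imports Defs "HOL-Probability.Characteristic_Functions"
begin

text \<open>Let \<open>I(\<alpha>)\<close> be the inner integral and average over a centred Gaussian \<open>\<alpha>\<close> of standard deviation
  \<open>s\<close> in every coordinate. Its density is at most \<open>s\<^sup>-\<^sup>N\<close>, so \<open>\<theta>\<^sub>k \<ge> s\<^sup>N E|I|\<^sup>2\<^sup>k \<ge> s\<^sup>N (E|I|\<^sup>2)\<^sup>k\<close> by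
  Jensen's inequality. As the Gaussian has a positive characteristic function, \<open>E|I|\<^sup>2\<close> is at least a
  constant times the probability that two independent points \<open>x\<close>, \<open>y\<close> of the cube satisfy
  \<open>|\<gamma>\<^sub>j(x) - \<gamma>\<^sub>j(y)| = O(1/s)\<close> for all \<open>j\<close>. Away from the coordinate hyperplanes all \<open>ln \<gamma>\<^sub>j\<close> are
  linear combinations of \<open>\<rho>\<close> of them, so the pigeonhole principle (Cauchy--Schwarz) on \<open>O(s\<^sup>\<rho>)\<close> cells bounds this
  probability below by a multiple of \<open>s\<^sup>-\<^sup>\<rho>\<close>. Hence \<open>\<theta>\<^sub>k \<ge> C s\<^sup>N\<^sup>-\<^sup>k\<^sup>\<rho> \<ge> C s\<close> for every integer \<open>s \<ge> 1\<close>.\<close>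

section \<open>Gaussian averages on Euclidean space\<close>

text \<open>Independent centred normal coordinates, given by a product density so that integrals
  over the space factor into one-dimensional ones.\<close>

definition gaussian :: "real \<Rightarrow> 'a::euclidean_space measure" where
  "gaussian s = density lborel (\<lambda>\<alpha>. ennreal (\<Prod>b\<in>Basis. normal_density 0 s (\<alpha> \<bullet> b)))"

lemma sets_gaussian [measurable_cong, simp]: "sets (gaussian s) = sets borel"
  and space_gaussian [simp]: "space (gaussian s) = UNIV"
  by (simp_all add: gaussian_def)

lemma prob_space_gaussian:
  assumes "s > 0"
  shows "prob_space (gaussian s :: 'a::euclidean_space measure)"
proof
  have "(\<integral>\<^sup>+\<alpha>. ennreal (\<Prod>b\<in>Basis. normal_density 0 s ((\<alpha>::'a) \<bullet> b)) \<partial>lborel)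
      = (\<integral>\<^sup>+\<alpha>. (\<Prod>b\<in>Basis. ennreal (normal_density 0 s ((\<alpha>::'a) \<bullet> b))) \<partial>lborel)"
    by (simp add: prod_ennreal)
  also have "\<dots> = (\<Prod>b\<in>(Basis::'a set). \<integral>\<^sup>+x. ennreal (normal_density 0 s x) \<partial>lborel)"
    by (intro nn_integral_lborel_prod) auto
  also have "(\<integral>\<^sup>+x. ennreal (normal_density 0 s x) \<partial>lborel) = 1"
    using prob_space.emeasure_space_1[OF prob_space_normal_density[OF assms, of 0]]
    by (simp add: emeasure_density)
  finally show "emeasure (gaussian s :: 'a measure) (space (gaussian s)) = 1"
    by (simp add: gaussian_def emeasure_density)
qed

text \<open>The substitution of \<open>s * x\<close> for \<open>x\<close> reduces the integral to
  the characteristic function of the standard normal distribution. Integrability follows by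
  domination, as \<open>cis\<close> has modulus 1.\<close>

lemma integral_normal_density_cis:
  assumes "s > 0"
  shows "(CLINT x|lborel. normal_density 0 s x *\<^sub>R cis (x * t)) = of_real (exp (- ((s * t)\<^sup>2 / 2)))"
    and "integrable lborel (\<lambda>x. normal_density 0 s x *\<^sub>R cis (x * t))"
proof -
  have eq: "normal_density 0 s (0 + s * x) *\<^sub>R cis ((0 + s * x) * t)
      = (1 / s) *\<^sub>R (std_normal_density x *\<^sub>R iexp ((s * t) * x))" for x
    using assms by (simp add: normal_density_def power_mult_distrib real_sqrt_mult cis_conv_exp
        mult_ac)
  have char: "(CLINT x|lborel. std_normal_density x *\<^sub>R iexp ((s * t) * x)) = of_real (exp (- ((s * t)\<^sup>2 / 2)))"
    using fun_cong[OF char_std_normal_distribution, of "s * t"]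
    by (simp add: char_def integral_density)
  show "(CLINT x|lborel. normal_density 0 s x *\<^sub>R cis (x * t)) = of_real (exp (- ((s * t)\<^sup>2 / 2)))"
  proof (subst lborel_integral_real_affine[where c=s and t=0])
    show "\<bar>s\<bar> *\<^sub>R (CLINT x|lborel. normal_density 0 s (0 + s * x) *\<^sub>R cis ((0 + s * x) * t))
        = of_real (exp (- ((s * t)\<^sup>2 / 2)))"
      unfolding eq integral_scaleR_right char using assms by simp
  qed (use assms in simp)
  show "integrable lborel (\<lambda>x. normal_density 0 s x *\<^sub>R cis (x * t))"
    by (rule Bochner_Integration.integrable_bound[OF integrable_normal_density[OF assms, of 0]])
       (auto simp: cis_conv_exp)
qed

lemma cis_sum: "finite A \<Longrightarrow> cis (\<Sum>b\<in>A. f b) = (\<Prod>b\<in>A. cis (f b))"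
  by (induction A rule: finite_induct) (auto simp: cis_mult[symmetric])

text \<open>Both the density and \<open>cis (\<alpha> \<bullet> v)\<close> are products over the
  coordinates, so Fubini splits the integral; the exponents then add up to the squared norm.\<close>

lemma char_gaussian:
  fixes v :: "'a::euclidean_space"
  assumes s: "s > 0"
  shows "(CLINT \<alpha>|gaussian s. cis (\<alpha> \<bullet> v)) = of_real (exp (- ((s * norm v)\<^sup>2 / 2)))"
proof -
  interpret product_sigma_finite "\<lambda>b::'a. lborel :: real measure" ..
  have [measurable]: "(\<lambda>\<alpha>::'a. (\<Prod>b\<in>Basis. normal_density 0 s (\<alpha> \<bullet> b))) \<in> borel_measurable borel"
    by measurable
  have [measurable]: "(\<lambda>\<alpha>::'a. cis (\<alpha> \<bullet> v)) \<in> borel_measurable borel"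
    by (intro borel_measurable_continuous_onI continuous_intros)
  have "(CLINT \<alpha>|gaussian s. cis (\<alpha> \<bullet> v))
      = (CLINT \<alpha>|lborel. (\<Prod>b\<in>Basis. normal_density 0 s (\<alpha> \<bullet> b)) *\<^sub>R cis (\<alpha> \<bullet> v))"
    unfolding gaussian_def by (subst integral_density) (auto intro!: prod_nonneg)
  also have "\<dots> = (CLINT f|(\<Pi>\<^sub>M b\<in>Basis. lborel).
      (\<Prod>b\<in>Basis. normal_density 0 s ((\<Sum>b\<in>Basis. f b *\<^sub>R b) \<bullet> b)) *\<^sub>R cis ((\<Sum>b\<in>Basis. f b *\<^sub>R b) \<bullet> v))"
    by (subst lborel_eq, subst integral_distr) simp_all
  also have "\<dots> = (CLINT f|(\<Pi>\<^sub>M b\<in>Basis. lborel).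
      (\<Prod>b\<in>Basis. normal_density 0 s (f b) *\<^sub>R cis (f b * (b \<bullet> v))))"
    by (intro Bochner_Integration.integral_cong refl)
       (simp add: inner_sum_left cis_sum prod.distrib scaleR_conv_of_real inner_Basis if_distrib
         cong: if_cong prod.cong)
  also have "\<dots> = (\<Prod>b\<in>Basis. CLINT x|lborel. normal_density 0 s x *\<^sub>R cis (x * (b \<bullet> v)))"
    by (rule product_integral_prod) (auto intro: integral_normal_density_cis s)
  also have "\<dots> = (\<Prod>b\<in>Basis. of_real (exp (- ((s * (b \<bullet> v))\<^sup>2 / 2))))"
    by (simp add: integral_normal_density_cis s)
  also have "\<dots> = of_real (exp (\<Sum>b\<in>Basis. - ((s * (b \<bullet> v))\<^sup>2 / 2)))"
    by (simp add: exp_sum)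
  also have "(\<Sum>b\<in>Basis. - ((s * (b \<bullet> v))\<^sup>2 / 2)) = - ((s * norm v)\<^sup>2 / 2)"
    by (simp add: power_mult_distrib sum_negf sum_divide_distrib[symmetric] sum_distrib_left[symmetric]
        power2_norm_eq_inner euclidean_inner[of v v] inner_commute power2_eq_square[symmetric])
  finally show ?thesis .
qed

text \<open>Each one-dimensional density is at most \<open>1 / (s * sqrt (2 * pi))\<close>, hence at
  most \<open>1 / s\<close>, so Lebesgue measure dominates \<open>s ^ DIM('a)\<close> times the
  Gaussian.\<close>

lemma nn_integral_gaussian_le:
  fixes f :: "'a::euclidean_space \<Rightarrow> ennreal"
  assumes s: "s > 0" and [measurable]: "f \<in> borel_measurable borel"
  shows "ennreal (s ^ DIM('a)) * (\<integral>\<^sup>+\<alpha>. f \<alpha> \<partial>gaussian s) \<le> (\<integral>\<^sup>+\<alpha>. f \<alpha> \<partial>lborel)"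
proof -
  have [measurable]: "(\<lambda>\<alpha>::'a. (\<Prod>b\<in>Basis. normal_density 0 s (\<alpha> \<bullet> b))) \<in> borel_measurable borel"
    by measurable
  have le: "s * normal_density 0 s x \<le> 1" for x
  proof -
    have "s / sqrt (2 * pi * s\<^sup>2) \<le> 1"
      using s pi_ge_two real_sqrt_ge_one[of "2 * pi"] by (simp add: real_sqrt_mult)
    moreover have "exp (- x\<^sup>2 / (2 * s\<^sup>2)) \<le> 1" by simp
    ultimately have "(s / sqrt (2 * pi * s\<^sup>2)) * exp (- x\<^sup>2 / (2 * s\<^sup>2)) \<le> 1"
      by (intro mult_le_one) auto
    then show ?thesis by (simp add: normal_density_def)
  qed
  have "s ^ DIM('a) * (\<Prod>b\<in>Basis. normal_density 0 s ((\<alpha>::'a) \<bullet> b)) \<le> 1" for \<alpha>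
  proof -
    have "s ^ DIM('a) * (\<Prod>b\<in>Basis. normal_density 0 s (\<alpha> \<bullet> b)) = (\<Prod>b\<in>Basis. s * normal_density 0 s (\<alpha> \<bullet> b))"
      by (simp add: prod.distrib)
    also have "\<dots> \<le> 1" using s le by (intro prod_le_1) auto
    finally show ?thesis .
  qed
  then have "ennreal (s ^ DIM('a)) * ennreal (\<Prod>b\<in>Basis. normal_density 0 s (\<alpha> \<bullet> b)) * f \<alpha> \<le> f \<alpha>" for \<alpha> :: 'a
    using s by (subst ennreal_mult[symmetric])
      (auto intro!: prod_nonneg mult_right_mono[of _ "1::ennreal", simplified] simp: ennreal_le_1)
  then have "(\<integral>\<^sup>+\<alpha>. ennreal (s ^ DIM('a)) * (ennreal (\<Prod>b\<in>Basis. normal_density 0 s (\<alpha> \<bullet> b)) * f \<alpha>) \<partial>lborel)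
      \<le> (\<integral>\<^sup>+\<alpha>. f \<alpha> \<partial>lborel)"
    by (intro nn_integral_mono) (simp add: mult.assoc)
  then show ?thesis
    by (simp add: gaussian_def nn_integral_density nn_integral_cmult)
qed

section \<open>Jensen, pigeonhole and the Gaussian second moment\<close>

text \<open>Jensen's inequality for the convex power function, obtained by integrating its tangent
  at the mean.\<close>

lemma (in prob_space) expectation_power_ge:
  fixes X :: "'a \<Rightarrow> real"
  assumes X: "integrable M X" "integrable M (\<lambda>x. X x ^ k)" "\<And>x. X x \<ge> 0"
  shows "expectation X ^ k \<le> expectation (\<lambda>x. X x ^ k)"
proof (cases k)
  case (Suc m)
  define t where "t = expectation X"
  have t: "t \<ge> 0" unfolding t_def using X(3) by simp
  \<comment> \<open>Bernoulli's inequality at \<open>x / t - 1\<close>, multiplied by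
    \<open>t ^ k\<close>; a zero mean is treated apart because of the division.\<close>
  have tangent: "t ^ k + k * t ^ m * (x - t) \<le> x ^ k" if x: "x \<ge> 0" for x
  proof (cases "t = 0")
    case True
    then show ?thesis using x Suc by (cases m) auto
  next
    case False
    with t have t0: "t > 0" by simp
    have "1 + k * (x / t - 1) \<le> (1 + (x / t - 1)) ^ k"
      using x t0 by (intro Bernoulli_inequality) simp
    then have "t ^ k * (1 + k * (x / t - 1)) \<le> t ^ k * (x / t) ^ k"
      using t0 by (intro mult_left_mono) auto
    moreover have "t ^ k * (1 + k * (x / t - 1)) = t ^ k + k * t ^ m * (x - t)"
      using t0 Suc by (simp add: field_simps)
    moreover have "t ^ k * (x / t) ^ k = x ^ k"
      using t0 by (simp add: power_divide)
    ultimately show ?thesis by simp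
  qed
  \<comment> \<open>The linear term integrates to zero since \<open>t\<close> is the mean of
    \<open>X\<close>.\<close>
  have "t ^ k = expectation (\<lambda>x. t ^ k + k * t ^ m * (X x - t))"
    using X by (simp add: prob_space t_def[symmetric])
  also have "\<dots> \<le> expectation (\<lambda>x. X x ^ k)"
    using X tangent by (intro integral_mono) auto
  finally show ?thesis by (simp add: t_def)
qed (simp add: prob_space)

text \<open>The squares of the fibres of \<open>f\<close> on \<open>X\<close> are disjoint, and
  \<open>h\<close> is at least \<open>c\<close> on each of them. By Cauchy--Schwarz the squared
  fibre probabilities sum to at least \<open>(prob X)\<^sup>2 / card T\<close>.\<close>

lemma (in prob_space) same_cell_bound:
  fixes h :: "'a \<times> 'a \<Rightarrow> real"
  assumes T: "finite T" "f ` X \<subseteq> T" and X [measurable]: "X \<in> events"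
    and meas: "\<And>t. t \<in> T \<Longrightarrow> {x \<in> X. f x = t} \<in> events"
    and h: "integrable (M \<Otimes>\<^sub>M M) h" "\<And>z. h z \<ge> 0"
    and c: "c \<ge> 0" "\<And>x y. x \<in> X \<Longrightarrow> y \<in> X \<Longrightarrow> f x = f y \<Longrightarrow> c \<le> h (x, y)"
  shows "c * (prob X)\<^sup>2 / card T \<le> (LINT z|(M \<Otimes>\<^sub>M M). h z)"
proof -
  interpret P: pair_prob_space M M ..
  define A where "A t = {x \<in> X. f x = t}" for t
  have A: "A t \<in> events" if "t \<in> T" for t using meas that by (simp add: A_def)
  have U: "(\<Union>t\<in>T. A t) = X" using T(2) by (auto simp: A_def)
  have disj: "disjoint_family_on A T" by (auto simp: A_def disjoint_family_on_def)
  have pX: "prob X = (\<Sum>t\<in>T. prob (A t))"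
    using finite_measure_finite_Union[OF T(1) _ disj] A U by auto
  have mA: "measure (M \<Otimes>\<^sub>M M) (A t \<times> A t) = (prob (A t))\<^sup>2" if "t \<in> T" for t
    using A[OF that] by (simp add: measure_def emeasure_pair_measure_Times enn2real_mult power2_eq_square)
  have "(prob X)\<^sup>2 \<le> (\<Sum>t\<in>T. (prob (A t))\<^sup>2) * card T"
    unfolding pX using Cauchy_Schwarz_ineq_sum[of "\<lambda>t. prob (A t)" "\<lambda>_. 1" T] by simp
  \<comment> \<open>If \<open>T\<close> is empty, the quotient is 0 by the convention for division
    by zero.\<close>
  then have "(prob X)\<^sup>2 / card T \<le> (\<Sum>t\<in>T. (prob (A t))\<^sup>2)"
    by (cases "card T = 0") (auto simp: divide_simps sum_nonneg)
  then have "c * ((prob X)\<^sup>2 / card T) \<le> c * (\<Sum>t\<in>T. (prob (A t))\<^sup>2)"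
    using c(1) by (intro mult_left_mono)
  also have "\<dots> = (LINT z|(M \<Otimes>\<^sub>M M). (\<Sum>t\<in>T. c * indicator (A t \<times> A t) z))"
    using A by (subst Bochner_Integration.integral_sum)
      (auto simp: mA sum_distrib_left P.emeasure_eq_measure intro!: sum.cong)
  also have "\<dots> \<le> (LINT z|(M \<Otimes>\<^sub>M M). h z)"
  proof (intro integral_mono h)
    show "integrable (M \<Otimes>\<^sub>M M) (\<lambda>z. \<Sum>t\<in>T. c * indicator (A t \<times> A t) z)"
      using A by (intro Bochner_Integration.integrable_sum integrable_mult_right)
        (auto simp: P.emeasure_eq_measure)
    fix z :: "'a \<times> 'a"
    obtain x y where z: "z = (x, y)" by force
    \<comment> \<open>Disjointness pointwise: only the cell with label \<open>f x\<close> can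
      contain the pair.\<close>
    have "(\<Sum>t\<in>T. c * indicator (A t \<times> A t) z) = (\<Sum>t\<in>T. if t = f x then c * indicator (A t \<times> A t) z else 0)"
      by (intro sum.cong) (auto simp: A_def z indicator_def)
    also have "\<dots> \<le> h z"
      using T h(2)[of z] c(2) by (auto simp: sum.delta' sum.delta[OF T(1)] indicator_def A_def z)
    finally show "(\<Sum>t\<in>T. c * indicator (A t \<times> A t) z) \<le> h z" .
  qed
  finally show ?thesis by simp
qed

text \<open>Expanding \<open>J \<alpha> * cnj (J \<alpha>)\<close> gives an integral over two
  independent points. Fubini moves the average over \<open>\<alpha>\<close> inside, where it becomes
  the positive Gaussian characteristic function at \<open>g x - g y\<close>.\<close>

lemma (in prob_space) gaussian_mean_square:
  fixes g :: "'a \<Rightarrow> 'b::euclidean_space"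
  assumes s: "s > 0" and g [measurable]: "g \<in> borel_measurable M"
  defines "J \<equiv> \<lambda>\<alpha>. (CLINT x|M. cis (\<alpha> \<bullet> g x))"
  shows "(LINT \<alpha>|gaussian s. (cmod (J \<alpha>))\<^sup>2)
       = (LINT z|(M \<Otimes>\<^sub>M M). exp (- ((s * norm (g (fst z) - g (snd z)))\<^sup>2 / 2)))"
proof -
  interpret G: prob_space "gaussian s :: 'b measure" by (rule prob_space_gaussian[OF s])
  interpret P: pair_prob_space M M ..
  interpret GP: pair_prob_space "gaussian s :: 'b measure" "M \<Otimes>\<^sub>M M" ..
  have [measurable]: "cis \<in> borel_measurable borel"
    by (intro borel_measurable_continuous_onI continuous_intros)
  define D where "D z = g (fst z) - g (snd z)" for z
  have [measurable]: "D \<in> borel_measurable (M \<Otimes>\<^sub>M M)"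
    unfolding D_def by measurable
  have sq: "complex_of_real ((cmod (J \<alpha>))\<^sup>2) = (CLINT z|(M \<Otimes>\<^sub>M M). cis (\<alpha> \<bullet> D z))" for \<alpha>
  proof -
    have "complex_of_real ((cmod (J \<alpha>))\<^sup>2) = J \<alpha> * cnj (J \<alpha>)"
      by (rule complex_norm_square)
    also have "\<dots> = (CLINT x|M. cis (\<alpha> \<bullet> g x) * (CLINT y|M. cis (- (\<alpha> \<bullet> g y))))"
      unfolding J_def using Bochner_Integration.integral_cnj[of M "\<lambda>y. cis (\<alpha> \<bullet> g y)"] by (simp add: cis_cnj)
    also have "\<dots> = (CLINT x|M. CLINT y|M. cis (\<alpha> \<bullet> D (x, y)))"
      by (simp add: D_def inner_diff_right cis_mult flip: integral_mult_right_zero)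
    also have "\<dots> = (CLINT z|(M \<Otimes>\<^sub>M M). cis (\<alpha> \<bullet> D z))"
      by (rule P.integral_fst') (rule P.integrable_const_bound[where B=1], auto)
    finally show ?thesis .
  qed
  have "complex_of_real (LINT \<alpha>|gaussian s. (cmod (J \<alpha>))\<^sup>2)
      = (CLINT \<alpha>|gaussian s. CLINT z|(M \<Otimes>\<^sub>M M). cis (\<alpha> \<bullet> D z))"
    unfolding sq[symmetric] by (rule integral_complex_of_real[symmetric])
  also have "\<dots> = (CLINT z|(M \<Otimes>\<^sub>M M). CLINT \<alpha>|gaussian s. cis (\<alpha> \<bullet> D z))"
    by (rule GP.Fubini_integral[symmetric]) (rule GP.P.integrable_const_bound[where B=1], auto)
  also have "\<dots> = complex_of_real (LINT z|(M \<Otimes>\<^sub>M M). exp (- ((s * norm (D z))\<^sup>2 / 2)))"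
    by (simp add: char_gaussian s)
  finally show ?thesis by (simp add: D_def)
qed

section \<open>Linear forms and logarithmic coordinates\<close>

text \<open>The constant is the sum of the absolute coefficients of \<open>a\<close> over
  \<open>B\<close>, so it does not depend on \<open>v\<close> or \<open>\<delta>\<close>. It carries
  closeness from a row basis to all rows.\<close>

lemma inner_bound_of_mem_span:
  fixes a :: "'a::real_inner"
  assumes "finite B" "a \<in> span B"
  obtains C where "C \<ge> 0" "\<And>v \<delta>. (\<And>b. b \<in> B \<Longrightarrow> \<bar>b \<bullet> v\<bar> \<le> \<delta>) \<Longrightarrow> \<bar>a \<bullet> v\<bar> \<le> C * \<delta>"
proof -
  obtain u where a: "a = (\<Sum>b\<in>B. u b *\<^sub>R b)"
    using assms by (auto simp: span_finite)
  show thesis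
  proof (rule that)
    show "(\<Sum>b\<in>B. \<bar>u b\<bar>) \<ge> 0" by (simp add: sum_nonneg)
    fix v \<delta> assume *: "\<And>b. b \<in> B \<Longrightarrow> \<bar>b \<bullet> v\<bar> \<le> \<delta>"
    have "\<bar>a \<bullet> v\<bar> \<le> (\<Sum>b\<in>B. \<bar>u b * (b \<bullet> v)\<bar>)"
      unfolding a by (simp add: inner_sum_left sum_abs)
    also have "\<dots> \<le> (\<Sum>b\<in>B. \<bar>u b\<bar> * \<delta>)"
      using * by (intro sum_mono) (auto simp: abs_mult intro: mult_left_mono)
    finally show "\<bar>a \<bullet> v\<bar> \<le> (\<Sum>b\<in>B. \<bar>u b\<bar>) * \<delta>" by (simp add: sum_distrib_right)
  qed
qed

text \<open>The derivative of \<open>exp\<close> is at most 1 on the nonpositive half-line; the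
  proof uses only \<open>exp y \<le> 1\<close> and \<open>1 + z \<le> exp z\<close>.\<close>

lemma abs_exp_diff_le:
  fixes a b :: real
  assumes "a \<le> 0" "b \<le> 0"
  shows "\<bar>exp a - exp b\<bar> \<le> \<bar>a - b\<bar>"
proof -
  have *: "exp y - exp x \<le> y - x" if "x \<le> y" "y \<le> 0" for x y :: real
  proof -
    have "exp y - exp x = exp y * (1 - exp (x - y))" by (simp add: exp_diff algebra_simps)
    also have "\<dots> \<le> 1 * (y - x)"
    proof (rule mult_mono)
      show "1 - exp (x - y) \<le> y - x" using exp_ge_add_one_self[of "x - y"] by linarith
    qed (use that in auto)
    finally show ?thesis by simp
  qed
  show ?thesis
  proof (cases "a \<le> b")
    case True
    then show ?thesis using *[of a b] assms by simp
  next
    case False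
    then show ?thesis using *[of b a] assms by simp
  qed
qed

definition log_vec :: "real ^ 'r \<Rightarrow> real ^ 'r" where
  "log_vec x = (\<chi> i. ln (x $ i))"

lemma measurable_inner_log_vec [measurable]: "(\<lambda>x. b \<bullet> log_vec x) \<in> borel_measurable borel"
proof -
  have [measurable]: "(\<lambda>x::real^'a. x $ i) \<in> borel_measurable borel" for i
    by (intro borel_measurable_continuous_onI continuous_intros)
  show ?thesis unfolding inner_vec_def log_vec_def by simp
qed

text \<open>In logarithmic coordinates the monomials become linear forms given by the rows of the
  exponent matrix; this is how the rank enters.\<close>

lemma monomial_eq_exp:
  assumes "\<And>i. x $ i > 0"
  shows "monomial (K $ j) x = exp (exponent_matrix K $ j \<bullet> log_vec x)"
  using assms
  by (auto simp: monomial_def exponent_matrix_def inner_vec_def log_vec_def exp_sum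
      exp_of_nat_mult intro!: prod.cong)

text \<open>A subcube of positive volume on which the logarithms of the coordinates are bounded and
  nonpositive.\<close>

definition upper_half_cube :: "(real ^ 'r) set" where
  "upper_half_cube = cbox (\<chi> i. 1 / 2) 1"

lemma mem_upper_half_cube: "x \<in> upper_half_cube \<longleftrightarrow> (\<forall>i. 1 / 2 \<le> x $ i \<and> x $ i \<le> 1)"
  by (auto simp: upper_half_cube_def mem_box_cart)

text \<open>Nonnegative exponents and nonpositive logarithms make both monomials exponentials of
  nonpositive numbers, where \<open>exp\<close> is 1-Lipschitz.\<close>

lemma monomial_diff_le:
  fixes K :: "nat ^ 'r ^ 'n"
  assumes "x \<in> upper_half_cube" "y \<in> upper_half_cube"
  shows "\<bar>monomial (K $ j) x - monomial (K $ j) y\<bar>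
    \<le> \<bar>exponent_matrix K $ j \<bullet> (log_vec x - log_vec y)\<bar>"
proof -
  have pos: "z $ i > 0" if "z \<in> upper_half_cube" for z :: "real ^ 'r" and i
    using that[unfolded mem_upper_half_cube] by (smt (verit) divide_pos_pos)
  have le: "exponent_matrix K $ j \<bullet> log_vec z \<le> 0" if "z \<in> upper_half_cube" for z
    using that pos[OF that]
    by (auto simp: exponent_matrix_def inner_vec_def log_vec_def mem_upper_half_cube
        intro!: sum_nonpos mult_nonneg_nonpos)
  show ?thesis
    using assms abs_exp_diff_le[OF le le, OF assms]
    by (simp add: monomial_eq_exp pos inner_diff_right)
qed

text \<open>On the interval from 1/2 to 1, \<open>ln\<close> has absolute value at most
  \<open>ln 2 < 1\<close>. The bound limits the number of cells needed below.\<close>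

lemma abs_inner_log_vec_le:
  assumes "x \<in> upper_half_cube"
  shows "\<bar>b \<bullet> log_vec x\<bar> \<le> (\<Sum>i\<in>UNIV. \<bar>b $ i\<bar>)"
proof -
  have "\<bar>ln (x $ i)\<bar> \<le> 1" for i
  proof -
    have x: "1 / 2 \<le> x $ i" "x $ i \<le> 1" using assms by (auto simp: mem_upper_half_cube)
    then have "ln (1 / 2) \<le> ln (x $ i)" by (subst ln_le_cancel_iff) auto
    moreover have "ln (x $ i) \<le> 0" using x by simp
    ultimately show ?thesis using ln_2_less_1 by (simp add: ln_div)
  qed
  then have "(\<Sum>i\<in>UNIV. \<bar>b $ i * ln (x $ i)\<bar>) \<le> (\<Sum>i\<in>UNIV. \<bar>b $ i\<bar>)"
    by (intro sum_mono) (simp add: abs_mult mult_left_le)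
  then show ?thesis
    unfolding inner_vec_def log_vec_def by (simp add: order_trans[OF sum_abs])
qed

section \<open>The uniform distribution on the cube and collisions of the monomial map\<close>

definition cube_measure :: "(real ^ 'r) measure" where
  "cube_measure = restrict_space lborel (cbox 0 1)"

lemma prob_space_cube_measure: "prob_space (cube_measure :: (real ^ 'r) measure)"
proof
  have "emeasure lborel (cbox 0 1 :: (real ^ 'r) set) = 1"
    by (subst emeasure_lborel_cbox) (auto simp: Basis_vec_def inner_axis intro!: prod.neutral)
  then show "emeasure cube_measure (space (cube_measure :: (real ^ 'r) measure)) = 1"
    by (simp add: cube_measure_def emeasure_restrict_space space_restrict_space)
qed

lemma upper_half_cube_subset: "upper_half_cube \<subseteq> cbox 0 1"
proof
  fix x :: "real ^ 'r" assume "x \<in> upper_half_cube"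
  then have "1 / 2 \<le> x $ i \<and> x $ i \<le> 1" for i by (simp add: mem_upper_half_cube)
  then have "0 \<le> x $ i \<and> x $ i \<le> 1" for i by (smt (verit) divide_pos_pos)
  then show "x \<in> cbox 0 1" by (simp add: mem_box_cart)
qed

lemma upper_half_cube_event: "upper_half_cube \<in> sets cube_measure"
  using upper_half_cube_subset
  by (auto simp: cube_measure_def sets_restrict_space_iff) (simp add: upper_half_cube_def)

lemma measure_upper_half_cube_pos: "measure cube_measure (upper_half_cube :: (real ^ 'r) set) > 0"
proof -
  have "measure cube_measure (upper_half_cube :: (real ^ 'r) set) = measure lborel (upper_half_cube :: (real ^ 'r) set)"
    unfolding cube_measure_def using upper_half_cube_subset by (intro measure_restrict_space) auto
  also have "\<dots> = (\<Prod>b\<in>(Basis :: (real ^ 'r) set). (1 - (\<chi> i. 1 / 2)) \<bullet> b)"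
    unfolding upper_half_cube_def
    by (subst measure_lborel_cbox) (auto simp: Basis_vec_def inner_axis)
  also have "\<dots> > 0" by (intro prod_pos) (auto simp: Basis_vec_def inner_axis)
  finally show ?thesis .
qed

text \<open>The factor \<open>2 * pi\<close> is absorbed here so that the full phase is the inner
  product with \<open>\<alpha>\<close>.\<close>

definition scaled_monomials :: "nat ^ 'r ^ 'n \<Rightarrow> real ^ 'r \<Rightarrow> real ^ 'n" where
  "scaled_monomials K x = (\<chi> j. 2 * pi * monomial (K $ j) x)"

lemma measurable_scaled_monomials [measurable]:
  "scaled_monomials K \<in> borel_measurable cube_measure"
proof -
  have "continuous_on UNIV (scaled_monomials K)"
    unfolding scaled_monomials_def monomial_def by (intro continuous_intros)
  then have "scaled_monomials K \<in> borel_measurable lborel"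
    by (simp add: borel_measurable_continuous_onI)
  then show ?thesis unfolding cube_measure_def by (rule measurable_restrict_space1)
qed

text \<open>Points are sorted by the floors of \<open>m\<close> times \<rho> independent linear
  forms in the logarithms. Points sharing a cell have all monomials within O(1/m), so the integrand
  is bounded below there, and there are only O(m^\<rho>) cells.\<close>

lemma cube_collision_bound:
  fixes K :: "nat ^ 'r ^ 'n"
  defines "g \<equiv> scaled_monomials K"
  obtains c :: real where "c > 0"
    "\<And>m::nat. m \<ge> 1 \<Longrightarrow> c / real m ^ rank (exponent_matrix K)
      \<le> (LINT z|(cube_measure \<Otimes>\<^sub>M cube_measure). exp (- ((real m * norm (g (fst z) - g (snd z)))\<^sup>2 / 2)))"
proof -
  have [measurable]: "g \<in> borel_measurable cube_measure" unfolding g_def by measurable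
  interpret Q: prob_space "cube_measure :: (real ^ 'r) measure" by (rule prob_space_cube_measure)
  interpret P: pair_prob_space "cube_measure :: (real ^ 'r) measure" "cube_measure :: (real ^ 'r) measure" ..
  let ?X = "upper_half_cube :: (real ^ 'r) set" and ?a = "\<lambda>j. exponent_matrix K $ j"
  define \<rho> where "\<rho> = rank (exponent_matrix K)"
  \<comment> \<open>A basis taken from the rows themselves; it has \<rho> elements because the rank
    is the dimension of the row space.\<close>
  obtain B where B: "B \<subseteq> rows (exponent_matrix K)" "independent B"
      "rows (exponent_matrix K) \<subseteq> span B" "card B = \<rho>"
    using basis_exists[of "rows (exponent_matrix K)"] unfolding \<rho>_def row_rank_def by metis
  have finB: "finite B" using B(2) by (rule independent_imp_finite)
  have "\<exists>C. C \<ge> 0 \<and> (\<forall>v \<delta>. (\<forall>b\<in>B. \<bar>b \<bullet> v\<bar> \<le> \<delta>) \<longrightarrow> \<bar>?a j \<bullet> v\<bar> \<le> C * \<delta>)" for j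
  proof -
    have "?a j \<in> rows (exponent_matrix K)"
      unfolding rows_def row_def by (auto simp: vec_nth_inverse)
    then have "?a j \<in> span B" using B(3) by auto
    then show ?thesis by (rule inner_bound_of_mem_span[OF finB]) blast
  qed
  then obtain C where C: "\<And>j. C j \<ge> 0"
      "\<And>j v \<delta>. (\<And>b. b \<in> B \<Longrightarrow> \<bar>b \<bullet> v\<bar> \<le> \<delta>) \<Longrightarrow> \<bar>?a j \<bullet> v\<bar> \<le> C j * \<delta>"
    by metis
  \<comment> \<open>Chosen so that \<open>norm (g x - g y) \<le> E / m\<close> within a cell, via
    the l1 norm.\<close>
  define E where "E = (\<Sum>j\<in>UNIV. 2 * pi * C j)"
  \<comment> \<open>A common bound for the basis forms on the subcube, an integer so that it
    delimits the floor values. Being at least 1, it later gives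
    \<open>2 * (m * D) + 1 \<le> 3 * D * m\<close>.\<close>
  obtain D :: nat where D: "D \<ge> 1" "\<And>b. b \<in> B \<Longrightarrow> (\<Sum>i\<in>UNIV. \<bar>b $ i\<bar>) \<le> D"
  proof -
    obtain D :: nat where D: "(\<Sum>b\<in>B. \<Sum>i\<in>UNIV. \<bar>b $ i\<bar>) \<le> D" using real_arch_simple by blast
    have "(\<Sum>i\<in>UNIV. \<bar>b $ i\<bar>) \<le> real (Suc D)" if "b \<in> B" for b
      using member_le_sum[OF that, of "\<lambda>b. \<Sum>i\<in>UNIV. \<bar>b $ i\<bar>"] finB D by (simp add: sum_nonneg)
    then show thesis using that[of "Suc D"] by simp
  qed
  define c0 where "c0 = exp (- (E\<^sup>2 / 2))"
  \<comment> \<open>\<open>c0\<close> bounds the integrand below on a shared cell, and the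
    denominator comes from the cell count \<open>(3 * D * m) ^ \<rho>\<close>; nothing here depends
    on \<open>m\<close>.\<close>
  define c where "c = c0 * (Q.prob ?X)\<^sup>2 / (3 * real D) ^ \<rho>"
  show thesis
  proof (rule that)
    show "c > 0" using D(1) measure_upper_half_cube_pos[where 'r='r] by (simp add: c_def c0_def)
    fix m :: nat assume m: "m \<ge> 1"
    define T where "T = B \<rightarrow>\<^sub>E {- int (m * D)..int (m * D)}"
    \<comment> \<open>Restricting to \<open>B\<close> fixes the value outside \<open>B\<close>, so
      labels are equal exactly when the floors agree on \<open>B\<close>.\<close>
    define f where "f x = (\<lambda>b\<in>B. \<lfloor>m * (b \<bullet> log_vec x)\<rfloor>)" for x :: "real ^ 'r"
    have finT: "finite T" unfolding T_def by (intro finite_PiE finB) auto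
    have T: "f ` ?X \<subseteq> T"
    proof safe
      fix x assume x: "x \<in> ?X"
      have "\<lfloor>m * (b \<bullet> log_vec x)\<rfloor> \<in> {- int (m * D)..int (m * D)}" if b: "b \<in> B" for b
      proof -
        have "\<bar>b \<bullet> log_vec x\<bar> \<le> D" using abs_inner_log_vec_le[OF x, of b] D(2)[OF b] by linarith
        then have "m * \<bar>b \<bullet> log_vec x\<bar> \<le> m * real D" by (intro mult_left_mono) auto
        then have "\<bar>m * (b \<bullet> log_vec x)\<bar> \<le> of_int (int (m * D))" by (simp add: abs_mult)
        then show ?thesis unfolding atLeastAtMost_iff by linarith
      qed
      then show "f x \<in> T" by (auto simp: f_def T_def)
    qed
    have meas: "{x \<in> ?X. f x = t} \<in> Q.events" if "t \<in> T" for t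
    proof -
      have "{x \<in> ?X. f x = t} = ?X \<inter> (\<Inter>b\<in>B. {x. \<lfloor>m * (b \<bullet> log_vec x)\<rfloor> = t b})"
        using that by (fastforce simp: f_def T_def PiE_def extensional_def fun_eq_iff)
      moreover have "\<dots> \<in> sets borel"
        using finB by (intro sets.Int sets.countable_INT'') (auto simp: upper_half_cube_def countable_finite)
      ultimately show ?thesis
        using upper_half_cube_subset by (auto simp: cube_measure_def sets_restrict_space_iff)
    qed
    have close: "c0 \<le> exp (- ((real m * norm (g x - g y))\<^sup>2 / 2))"
      if xy: "x \<in> ?X" "y \<in> ?X" "f x = f y" for x y
    proof -
      have "\<bar>b \<bullet> (log_vec x - log_vec y)\<bar> \<le> 1 / m" if b: "b \<in> B" for b
      proof -
        have "\<lfloor>m * (b \<bullet> log_vec x)\<rfloor> = \<lfloor>m * (b \<bullet> log_vec y)\<rfloor>"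
          using fun_cong[OF xy(3), of b] b by (simp add: f_def)
        \<comment> \<open>Numbers with equal floors differ by less than 1.\<close>
        then have "\<bar>m * (b \<bullet> log_vec x) - m * (b \<bullet> log_vec y)\<bar> \<le> 1" by linarith
        moreover have "m * (b \<bullet> log_vec x) - m * (b \<bullet> log_vec y) = m * (b \<bullet> (log_vec x - log_vec y))"
          by (simp add: inner_diff_right algebra_simps)
        ultimately show ?thesis using m by (simp add: abs_mult field_simps)
      qed
      then have aC: "\<bar>?a j \<bullet> (log_vec x - log_vec y)\<bar> \<le> C j * (1 / m)" for j by (rule C(2))
      have "norm (g x - g y) \<le> (\<Sum>j\<in>UNIV. \<bar>(g x - g y) $ j\<bar>)" by (rule norm_le_l1_cart)
      also have "\<dots> \<le> (\<Sum>j\<in>UNIV. 2 * pi * C j / m)"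
      proof (rule sum_mono)
        fix j
        have "\<bar>monomial (K $ j) x - monomial (K $ j) y\<bar> \<le> C j * (1 / m)"
          using monomial_diff_le[OF xy(1,2), of K j] aC[of j] by linarith
        then have "2 * pi * \<bar>monomial (K $ j) x - monomial (K $ j) y\<bar> \<le> 2 * pi * (C j * (1 / m))"
          by (intro mult_left_mono) auto
        then show "\<bar>(g x - g y) $ j\<bar> \<le> 2 * pi * C j / m"
          by (simp add: g_def scaled_monomials_def abs_mult flip: right_diff_distrib)
      qed
      also have "\<dots> = E / m" by (simp add: E_def sum_divide_distrib)
      finally have "m * norm (g x - g y) \<le> E" using m by (simp add: field_simps)
      then show ?thesis by (auto simp: c0_def intro!: power_mono)
    qed
    have "c / real m ^ \<rho> \<le> c0 * (Q.prob ?X)\<^sup>2 / card T"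
    proof -
      have "card T = (2 * (m * D) + 1) ^ \<rho>"
        unfolding T_def using finB B(4)
        by (simp add: card_PiE nat_add_distrib nat_mult_distrib mult.commute)
      also have "\<dots> \<le> (3 * D * m) ^ \<rho>" using m D(1) by (intro power_mono) auto
      finally have le: "real (card T) \<le> (3 * real D) ^ \<rho> * real m ^ \<rho>"
        by (simp add: power_mult_distrib flip: of_nat_le_iff[where 'a=real])
      have "card T > 0" using \<open>card T = _\<close> by simp
      then show ?thesis
        using le unfolding c_def by (auto simp: c0_def intro!: divide_left_mono)
    qed
    also have "\<dots> \<le> (LINT z|(cube_measure \<Otimes>\<^sub>M cube_measure). exp (- ((real m * norm (g (fst z) - g (snd z)))\<^sup>2 / 2)))"
    proof (rule Q.same_cell_bound[OF finT T upper_half_cube_event meas])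
      show "integrable (cube_measure \<Otimes>\<^sub>M cube_measure) (\<lambda>z. exp (- ((real m * norm (g (fst z) - g (snd z)))\<^sup>2 / 2)))"
        by (rule P.P.integrable_const_bound[where B=1]) auto
      show "c0 \<ge> 0" by (simp add: c0_def)
    qed (use close in auto)
    finally show "c / real m ^ rank (exponent_matrix K)
      \<le> (LINT z|(cube_measure \<Otimes>\<^sub>M cube_measure). exp (- ((real m * norm (g (fst z) - g (snd z)))\<^sup>2 / 2)))"
      by (simp add: \<rho>_def)
  qed
qed

section \<open>Divergence of the special integral\<close>

lemma trig_integral_eq:
  "trig_integral K \<alpha> = (CLINT x|cube_measure. cis (\<alpha> \<bullet> scaled_monomials K x))"
proof -
  have "\<alpha> \<bullet> scaled_monomials K x = 2 * pi * phase K \<alpha> x" for x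
    by (simp add: inner_vec_def scaled_monomials_def phase_def sum_distrib_left mult_ac)
  then show ?thesis
    unfolding trig_integral_def cube_measure_def set_lebesgue_integral_def
    by (subst integral_restrict_space) (simp_all add: cis_conv_exp mult_ac)
qed

theorem theorem1:
  fixes K :: "nat ^ 'r ^ 'n" and k :: nat
  assumes distinct_monomials: "\<And>j j'. j \<noteq> j' \<Longrightarrow> monomial (K $ j) \<noteq> monomial (K $ j')"
    and positive_degree: "\<And>j. (\<Sum>i\<in>UNIV. K $ j $ i) > 0"
    and small_k: "k * rank (exponent_matrix K) < CARD('n)"
  shows "special_integral k K = \<infinity>"
proof -
  interpret Q: prob_space "cube_measure :: (real ^ 'r) measure" by (rule prob_space_cube_measure)
  define g :: "real ^ 'r \<Rightarrow> real ^ 'n" where "g = scaled_monomials K"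
  have [measurable]: "g \<in> borel_measurable cube_measure" unfolding g_def by measurable
  define J where "J \<alpha> = (CLINT x|cube_measure. cis (\<alpha> \<bullet> g x))" for \<alpha>
  have J: "trig_integral K = J" by (simp add: fun_eq_iff trig_integral_eq J_def g_def)
  let ?\<rho> = "rank (exponent_matrix K)"
  obtain c :: real where c: "c > 0" "\<And>m::nat. m \<ge> 1 \<Longrightarrow> c / real m ^ ?\<rho>
      \<le> (LINT z|(cube_measure \<Otimes>\<^sub>M cube_measure). exp (- ((real m * norm (g (fst z) - g (snd z)))\<^sup>2 / 2)))"
    by (rule cube_collision_bound[of K, folded g_def]) blast
  have [measurable]: "cis \<in> borel_measurable borel"
    by (intro borel_measurable_continuous_onI continuous_intros)
  have J_meas [measurable]: "J \<in> borel_measurable borel"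
    unfolding J_def by measurable
  \<comment> \<open>This makes every power of \<open>cmod (J \<alpha>)\<close> integrable under the
    Gaussian, as Jensen's inequality requires.\<close>
  have J_le: "cmod (J \<alpha>) \<le> 1" for \<alpha>
  proof -
    have "cmod (J \<alpha>) \<le> (LINT x|cube_measure. cmod (cis (\<alpha> \<bullet> g x)))"
      unfolding J_def by (rule integral_norm_bound)
    then show ?thesis by (simp add: Q.prob_space)
  qed
  \<comment> \<open>A lower bound growing linearly in the standard deviation \<open>m\<close> of the
    Gaussian.\<close>
  have bound: "ennreal (real m * c ^ k) \<le> special_integral k K" if m: "m \<ge> 1" for m :: nat
  proof -
    interpret G: prob_space "gaussian m :: (real ^ 'n) measure"
      using m by (intro prob_space_gaussian) simp
    have int: "integrable (gaussian m) (\<lambda>\<alpha>. cmod (J \<alpha>) ^ i)" for i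
      using J_le by (intro G.integrable_const_bound[where B=1]) (auto simp: power_le_one)
    have "c / real m ^ ?\<rho> \<le> G.expectation (\<lambda>\<alpha>. (cmod (J \<alpha>))\<^sup>2)"
      using c(2)[OF m] Q.gaussian_mean_square[of m g] m by (simp add: J_def)
    then have "(c / real m ^ ?\<rho>) ^ k \<le> G.expectation (\<lambda>\<alpha>. (cmod (J \<alpha>))\<^sup>2) ^ k"
      using c(1) by (intro power_mono) auto
    also have "\<dots> \<le> G.expectation (\<lambda>\<alpha>. ((cmod (J \<alpha>))\<^sup>2) ^ k)"
      by (intro G.expectation_power_ge) (auto simp: int simp flip: power_mult)
    finally have E: "(c / real m ^ ?\<rho>) ^ k \<le> G.expectation (\<lambda>\<alpha>. cmod (J \<alpha>) ^ (2 * k))"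
      by (simp add: power_mult)
    \<comment> \<open>By \<open>small_k\<close> the exponent is at least 1 and the natural
      subtraction does not truncate.\<close>
    have "real m * c ^ k \<le> real m ^ (CARD('n) - k * ?\<rho>) * c ^ k"
    proof (rule mult_right_mono)
      show "real m \<le> real m ^ (CARD('n) - k * ?\<rho>)"
        using m small_k by (intro self_le_power) auto
    qed (use c(1) in simp)
    also have "\<dots> = real m ^ CARD('n) * (c / real m ^ ?\<rho>) ^ k"
    proof -
      have "real m ^ (CARD('n) - k * ?\<rho>) = real m ^ CARD('n) / (real m ^ ?\<rho>) ^ k"
        using m small_k by (simp add: power_diff mult.commute flip: power_mult)
      then show ?thesis by (simp add: power_divide)
    qed
    also have "\<dots> \<le> real m ^ CARD('n) * G.expectation (\<lambda>\<alpha>. cmod (J \<alpha>) ^ (2 * k))"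
      using E by (intro mult_left_mono) auto
    finally have "ennreal (real m * c ^ k) \<le> ennreal (real m ^ CARD('n)) * ennreal (G.expectation (\<lambda>\<alpha>. cmod (J \<alpha>) ^ (2 * k)))"
      by (simp add: ennreal_mult' [symmetric])
    also have "\<dots> = ennreal (real m ^ CARD('n)) * (\<integral>\<^sup>+\<alpha>. ennreal (cmod (J \<alpha>) ^ (2 * k)) \<partial>gaussian m)"
      by (subst nn_integral_eq_integral[OF int]) auto
    also have "\<dots> \<le> special_integral k K"
      unfolding special_integral_def J
      using nn_integral_gaussian_le[of "real m" "\<lambda>\<alpha>::real^'n. ennreal (cmod (J \<alpha>) ^ (2 * k))"] m by simp
    finally show ?thesis .
  qed
  show ?thesis
  proof (rule ccontr)
    assume "special_integral k K \<noteq> \<infinity>"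
    then obtain t where t: "t \<ge> 0" "special_integral k K = ennreal t"
      by (cases "special_integral k K") auto
    \<comment> \<open>A finite value \<open>t\<close> would bound \<open>m * c ^ k\<close> for all
      \<open>m \<ge> 1\<close>, against the Archimedean property.\<close>
    obtain m :: nat where m: "m > t / c ^ k" using reals_Archimedean2 by blast
    moreover have "t / c ^ k \<ge> 0" using t(1) c(1) by simp
    ultimately have "m \<ge> 1" by (cases m) auto
    then have "m * c ^ k \<le> t" using bound[of m] t by simp
    with m c(1) show False by (simp add: field_simps)
  qed
qed

end
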